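(* Let $d\ge 2$, and let $0<r_1<r_2<\cdots<r_{d-1}$ and $0<t_1<t_2<\cdots<t_{d-1}$ be natural numbers. If $\alpha=(\alpha_n)_{n\in\mathbb{N}_0}$ is a Hausdorff moment sequence, then so is the sequence $$\left(\det \begin{bmatrix} \alpha_{n} & \alpha_{n+r_1} & \cdots & \alpha_{n+r_{d-1}} \\ \alpha_{n+t_1} & \alpha_{n+r_1+t_1} & \cdots & \alpha_{n+r_{d-1}+t_1} \\ \vdots & \vdots & \ddots & \vdots \\ \alpha_{n+t_{d-1}} & \alpha_{n+r_1+t_{d-1}} & \cdots & \alpha_{n+r_{d-1}+t_{d-1}} \end{bmatrix}\right)_{n\in\mathbb{N}_0}.$$
   Context: $\mathbb{N}_0$ denotes the set of nonnegative integers. A real sequence $\alpha=(\alpha_n)_{n\in\mathbb{N}_0}$ is a Hausdorff moment sequence if there is a nonnegative Borel measure $\mu$ on $\mathbb{R}$ with $\operatorname{supp}(\mu)\subset[0,1]$ such that $\alpha_n=\int_{[0,1]} x^n\,d\mu$ for all $n\in\mathbb{N}_0$ (all these integrals existing). *)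

theory Defs
  imports "HOL-Analysis.Set_Integral" "Jordan_Normal_Form.Determinant"
begin

text \<open>The (closed) topological support of a measure on the Borel sets of a topological space.\<close>

definition measure_support :: "'a::topological_space measure \<Rightarrow> 'a set" where
  "measure_support \<mu> = {x. \<forall>U. open U \<and> x \<in> U \<longrightarrow> emeasure \<mu> U > 0}"

text \<open>
  The integrability clause makes all moments exist; at \<open>n = 0\<close> it forces \<open>\<mu>\<close> to have finite mass
  on \<open>[0,1]\<close>. The convention \<open>0 ^ 0 = 1\<close> is in force, so an atom at 0 contributes to \<open>\<alpha> 0\<close>.
\<close>

definition hausdorff_moment_sequence :: "(nat \<Rightarrow> real) \<Rightarrow> bool" where
  "hausdorff_moment_sequence \<alpha> \<longleftrightarrow>
     (\<exists>\<mu> :: real measure. sets \<mu> = sets borel \<and> measure_support \<mu> \<subseteq> {0..1} \<and>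
        (\<forall>n. set_integrable \<mu> {0..1} (\<lambda>x. x ^ n) \<and>
             \<alpha> n = set_lebesgue_integral \<mu> {0..1} (\<lambda>x. x ^ n)))"

end

theory Submission
  imports Defs
begin

text \<open>
  If \<open>\<nu>\<close> represents \<open>\<alpha>\<close> on \<open>[0,1]\<close>, expanding both determinants over permutations gives
  \<open>d! det (\<alpha>\<^bsub>n + r j + t i\<^esub>) = \<integral> (\<Prod>i. x i)\<^sup>n det (x i ^ t j) det (x i ^ r j) d\<nu>\<^sup>d(x)\<close>.
  The two generalized Vandermonde determinants have the same sign on the nonnegative orthant, so the
  image of their product with \<open>\<nu>\<^sup>d\<close> under \<open>x \<mapsto> \<Prod>i. x i\<close> is a nonnegative measure on \<open>[0,1]\<close>;
  up to the factor \<open>d!\<close> its moments are the given determinants.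
\<close>

section \<open>Generalized Vandermonde determinants\<close>

text \<open>Induction on \<open>S\<close>, adding zeros from left to right: Rolle's theorem between
  the old maximum and the new zero \<open>b\<close> yields one more zero of \<open>f'\<close>. The
  clause \<open>x < Max S\<close> keeps the earlier critical points below the old maximum, so the
  new one is distinct from them.\<close>

lemma Rolle_card_zeros:
  fixes f f' :: "real \<Rightarrow> real"
  assumes "finite S" "S \<noteq> {}" "\<And>x. x \<in> S \<Longrightarrow> a < x \<and> f x = 0"
    and f': "\<And>x. a < x \<Longrightarrow> (f has_real_derivative f' x) (at x)"
  shows "\<exists>T. finite T \<and> card S \<le> Suc (card T) \<and> (\<forall>x\<in>T. a < x \<and> x < Max S \<and> f' x = 0)"
  using assms(1-3)
proof (induction S rule: finite_linorder_max_induct)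
  case empty
  then show ?case by simp
next
  case (insert b S)
  show ?case
  proof (cases "S = {}")
    case True
    then show ?thesis by (intro exI[of _ "{}"]) auto
  next
    case False
    let ?m = "Max S"
    obtain T where T: "finite T" "card S \<le> Suc (card T)"
        "\<And>x. x \<in> T \<Longrightarrow> a < x \<and> x < ?m \<and> f' x = 0"
      using insert.IH False insert.prems by auto
    have m: "?m \<in> S" using insert.hyps False by simp
    have mb: "?m < b" and zeros: "a < ?m" "f ?m = 0" "f b = 0"
      using m insert.hyps insert.prems by auto
    have "\<exists>z. ?m < z \<and> z < b \<and> f' z = 0"
    proof -
      have "\<exists>z>?m. z < b \<and> (*) (f' z) = (\<lambda>v. 0)"
      proof (rule Rolle_deriv[OF mb])
        show "f ?m = f b" using zeros by simp
        show "continuous_on {?m..b} f"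
          using f' zeros by (intro continuous_at_imp_continuous_on ballI DERIV_isCont[OF f']) auto
        show "(f has_derivative (*) (f' x)) (at x)" if "?m < x" "x < b" for x
          using f'[of x] zeros that by (simp add: has_field_derivative_def)
      qed
      then obtain z where z: "?m < z" "z < b" "(*) (f' z) = (\<lambda>v. 0)" by auto
      from z(3) have "f' z * 1 = 0" by (rule fun_cong)
      with z(1,2) show ?thesis by auto
    qed
    then obtain z where z: "?m < z" "z < b" "f' z = 0" by auto
    have zT: "z \<notin> T" using T(3)[of z] z by auto
    have "b \<notin> S" using insert.hyps by auto
    moreover have "Max (insert b S) = b" using insert.hyps mb False by simp
    moreover have "a < x \<and> x < b \<and> f' x = 0" if "x \<in> insert z T" for x
      using that T(3)[of x] z zeros mb by auto
    ultimately show ?thesis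
      using T zT insert.hyps by (intro exI[of _ "insert z T"]) auto
  qed
qed

text \<open>A weak form of Descartes' rule of signs: a nontrivial combination of \<open>d\<close>
  monomials has fewer than \<open>d\<close> positive zeros. Division by the lowest power makes the
  lowest term constant, differentiation removes it, and by Rolle at most one zero is lost; so
  induction on the number of terms applies.\<close>

lemma real_fewnomial_zeros:
  fixes c :: "nat \<Rightarrow> real" and r :: "nat \<Rightarrow> nat"
  assumes "strict_mono_on {0..<d} r" "finite S" "d \<le> card S"
    and "\<And>x. x \<in> S \<Longrightarrow> 0 < x \<and> (\<Sum>j<d. c j * x ^ r j) = 0"
  shows "\<forall>j<d. c j = 0"
  using assms
proof (induction d arbitrary: r c S)
  case 0
  then show ?case by simp
next
  case (Suc d)
  define s where "s j = r j - r 0" for j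
  have le: "r 0 \<le> r j" if "j < Suc d" for j
    using strict_mono_onD[OF Suc.prems(1), of 0 j] that by (cases j) auto
  have s0: "s 0 = 0" by (simp add: s_def)
  have s_less: "s i < s j" if "i < j" "j < Suc d" for i j
    using strict_mono_onD[OF Suc.prems(1), of i j] that le[of i] by (auto simp: s_def)
  have factor: "(\<Sum>j<Suc d. c j * x ^ r j) = x ^ r 0 * (\<Sum>j<Suc d. c j * x ^ s j)" for x
    unfolding sum_distrib_left
    by (rule sum.cong) (auto simp: s_def le simp flip: power_add)
  define g where "g x = (\<Sum>j<Suc d. c j * x ^ s j)" for x
  define c' where "c' j = c (Suc j) * real (s (Suc j))" for j
  \<comment> \<open>The subtraction does not truncate for \<open>j < d\<close>, since
    \<open>s (Suc j) > s 0 = 0\<close>.\<close>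
  define r' where "r' j = s (Suc j) - 1" for j
  define g' where "g' x = (\<Sum>j<d. c' j * x ^ r' j)" for x
  have deriv: "(g has_real_derivative g' x) (at x)" for x
    unfolding g_def g'_def c'_def r'_def sum.lessThan_Suc_shift
    by (auto intro!: derivative_eq_intros sum.cong simp: s0)
  have S: "0 < x \<and> g x = 0" if "x \<in> S" for x
    using Suc.prems(4)[OF that] factor[of x] by (auto simp: g_def)
  have ne: "S \<noteq> {}" using Suc.prems(3) by auto
  obtain T where T: "finite T" "card S \<le> Suc (card T)" "\<forall>x\<in>T. 0 < x \<and> x < Max S \<and> g' x = 0"
    using Rolle_card_zeros[OF Suc.prems(2) ne S deriv] by auto
  have c': "\<forall>j<d. c' j = 0"
  proof (rule Suc.IH[of r' T c'])
    show "strict_mono_on {0..<d} r'"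
    proof (rule strict_mono_onI)
      fix i j assume "i \<in> {0..<d}" "j \<in> {0..<d}" "i < j"
      then show "r' i < r' j"
        using s_less[of "Suc i" "Suc j"] s_less[of 0 "Suc i"] by (simp add: r'_def)
    qed
    show "d \<le> card T" using T(2) Suc.prems(3) by simp
    show "0 < x \<and> (\<Sum>j<d. c' j * x ^ r' j) = 0" if "x \<in> T" for x
      using T(3) that by (auto simp: g'_def)
  qed (fact T)
  have pos: "c (Suc j) = 0" if "j < d" for j
    using c' that s_less[of 0 "Suc j"] by (auto simp: c'_def)
  \<comment> \<open>All nonconstant terms are gone, so a single zero of \<open>g\<close> forces the
    constant term \<open>c 0\<close> to vanish.\<close>
  obtain x where "x \<in> S" using ne by auto
  from S[OF this] have "c 0 = 0"
    unfolding g_def sum.lessThan_Suc_shift using pos by (simp add: s0)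
  with pos show ?case by (auto simp: less_Suc_eq_0_disj)
qed

section \<open>Positivity of the determinant at increasing nodes\<close>

text \<open>This gives the sign near infinity. After the division, term \<open>j\<close> carries
  \<open>inverse y ^ (r d - r j)\<close>: the exponent is positive for \<open>j < d\<close>, and the
  term \<open>j = d\<close> survives through \<open>0 ^ 0 = 1\<close>.\<close>

lemma fewnomial_leading_tendsto:
  fixes c :: "nat \<Rightarrow> real" and r :: "nat \<Rightarrow> nat"
  assumes "strict_mono_on {0..<Suc d} r"
  shows "((\<lambda>y. (\<Sum>j<Suc d. c j * y ^ r j) / y ^ r d) \<longlongrightarrow> c d) at_top"
proof -
  have lim: "((\<lambda>y. c j * inverse y ^ (r d - r j)) \<longlongrightarrow> c j * 0 ^ (r d - r j)) at_top" for j
    by (intro tendsto_intros tendsto_inverse_0_at_top filterlim_ident)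
  have "((\<lambda>y. \<Sum>j<Suc d. c j * inverse y ^ (r d - r j)) \<longlongrightarrow>
      (\<Sum>j<Suc d. c j * 0 ^ (r d - r j))) at_top"
    by (intro tendsto_sum lim)
  moreover have "(\<Sum>j<Suc d. c j * 0 ^ (r d - r j)) = c d"
  proof -
    have "c j * 0 ^ (r d - r j) = 0" if "j < d" for j
      using strict_mono_onD[OF assms, of j d] that by simp
    then have "(\<Sum>j<d. c j * 0 ^ (r d - r j)) = 0" by (intro sum.neutral) simp
    then show ?thesis by simp
  qed
  moreover have "eventually (\<lambda>y. (\<Sum>j<Suc d. c j * inverse y ^ (r d - r j)) =
      (\<Sum>j<Suc d. c j * y ^ r j) / y ^ r d) at_top"
    using eventually_gt_at_top[of 0]
  proof eventually_elim
    case (elim y)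
    have "r j \<le> r d" if "j < Suc d" for j
      using strict_mono_onD[OF assms, of j d] that by (cases "j = d") auto
    then show ?case
      unfolding sum_divide_distrib using elim
      by (intro sum.cong) (auto simp: power_diff field_simps)
  qed
  ultimately show ?thesis by (auto elim: Lim_transform_eventually)
qed

text \<open>As a function of the last node, the determinant is a sum of \<open>d + 1\<close> monomials that
  vanishes at the other \<open>d\<close> nodes. It has no further positive zero, so beyond them its sign is that
  of its leading coefficient, which is the determinant of size \<open>d\<close>.\<close>

lemma det_powers_pos:
  fixes x :: "nat \<Rightarrow> real" and r :: "nat \<Rightarrow> nat"
  assumes "strict_mono_on {0..<d} r" "strict_mono_on {0..<d} x" "\<And>i. i < d \<Longrightarrow> 0 < x i"
  shows "0 < det (mat d d (\<lambda>(i, j). x i ^ r j))"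
  using assms
proof (induction d)
  case 0
  then show ?case by (simp add: det_def)
next
  case (Suc d)
  define M where "M y = mat (Suc d) (Suc d) (\<lambda>(i, j). (x(d := y)) i ^ r j)" for y
  have M: "M y \<in> carrier_mat (Suc d) (Suc d)" for y by (simp add: M_def)
  \<comment> \<open>Only row \<open>d\<close> contains \<open>y\<close>, and the cofactors along
    that row omit it. They are therefore independent of \<open>y\<close>, and the node 0 is an
    arbitrary choice.\<close>
  define c where "c j = cofactor (M 0) d j" for j
  have cof: "cofactor (M y) d j = c j" if "j < Suc d" for y j
    unfolding c_def cofactor_def
    by (rule arg_cong[where f = "\<lambda>A. _ * det A"]) (rule eq_matI, auto simp: mat_delete_def M_def that)
  define p where "p y = (\<Sum>j<Suc d. c j * y ^ r j)" for y
  have det: "det (M y) = p y" for y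
    unfolding laplace_expansion_row[OF M, of d y, OF lessI] p_def
    by (rule sum.cong) (auto simp: cof, simp_all add: M_def)
  have c_pos: "0 < c d"
  proof -
    have "mat_delete (M 0) d d = mat d d (\<lambda>(i, j). x i ^ r j)"
      by (rule eq_matI) (auto simp: mat_delete_def M_def)
    then have "c d = det (mat d d (\<lambda>(i, j). x i ^ r j))"
      unfolding c_def cofactor_def by simp
    then show ?thesis using Suc by (auto simp: strict_mono_on_def)
  qed
  have zero: "p (x i) = 0" if "i < d" for i
    unfolding det[symmetric]
    by (rule det_identical_rows[OF M, of i d]) (use that in \<open>auto simp: M_def\<close>)
  have inj: "inj_on x {0..<Suc d}" using Suc.prems(2) by (rule strict_mono_on_imp_inj_on)
  have no_zero: "p y \<noteq> 0" if y: "x d \<le> y" for y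
  proof
    assume "p y = 0"
    have less: "x i < y" if "i < d" for i
      using strict_mono_onD[OF Suc.prems(2), of i d] that y by auto
    \<comment> \<open>Together with the \<open>d\<close> smaller nodes, \<open>y\<close> would be
      zero number \<open>d + 1\<close> of a sum of \<open>d + 1\<close> monomials, forcing
      \<open>c d = 0\<close>.\<close>
    have "inj_on x {..<d}" by (rule inj_on_subset[OF inj]) auto
    then have "card (insert y (x ` {..<d})) = Suc d"
      using less by (subst card_insert_disjoint) (auto simp: card_image)
    moreover have "0 < z \<and> (\<Sum>j<Suc d. c j * z ^ r j) = 0" if "z \<in> insert y (x ` {..<d})" for z
      using that zero \<open>p y = 0\<close> Suc.prems(3) y by (fastforce simp: p_def)
    ultimately have "\<forall>j<Suc d. c j = 0"
      by (intro real_fewnomial_zeros[OF Suc.prems(1), of "insert y (x ` {..<d})"]) auto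
    with c_pos show False by simp
  qed
  have "eventually (\<lambda>y. 0 < p y / y ^ r d) at_top"
    using order_tendstoD(1)[OF fewnomial_leading_tendsto[OF Suc.prems(1), of c] c_pos]
    unfolding p_def .
  \<comment> \<open>The 0 in \<open>max\<close> makes \<open>y ^ r d\<close> positive, so the sign
    of the quotient is that of \<open>p y\<close>.\<close>
  with eventually_gt_at_top[of "max 0 (x d)"]
  have "eventually (\<lambda>y. x d < y \<and> 0 < p y) at_top"
    by eventually_elim (auto simp: zero_less_divide_iff)
  then obtain y where y: "x d < y" "0 < p y"
    by (auto dest: eventually_happens)
  have "0 < p (x d)"
  proof (rule ccontr)
    assume "\<not> 0 < p (x d)"
    moreover have "continuous_on {x d..y} p"
      unfolding p_def by (intro continuous_intros)
    ultimately obtain z where "x d \<le> z" "p z = 0"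
      using IVT'[of p "x d" 0 y] y by auto
    with no_zero show False by blast
  qed
  moreover have "M (x d) = mat (Suc d) (Suc d) (\<lambda>(i, j). x i ^ r j)"
    by (simp add: M_def)
  ultimately show ?case by (simp flip: det)
qed

section \<open>Equal signs on the nonnegative orthant\<close>

lemma permutes_sort:
  fixes x :: "nat \<Rightarrow> 'a::linorder"
  assumes "inj_on x {0..<d}"
  obtains p where "p permutes {0..<d}" "strict_mono_on {0..<d} (x \<circ> p)"
proof -
  let ?xs = "map x [0..<d]"
  have "mset (sort ?xs) = mset ?xs" by simp
  then obtain p where p: "p permutes {..<length ?xs}" "permute_list p ?xs = sort ?xs"
    by (rule mset_eq_permutation)
  have p': "p permutes {0..<d}" using p(1) by (simp add: atLeast0LessThan)
  have nth: "sort ?xs ! i = x (p i)" if "i < d" for i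
    using that permutes_in_image[OF p', of i] permute_list_nth[OF p(1), of i]
    by (simp flip: p(2))
  have "sorted_wrt (<) (sort ?xs)"
    using assms by (simp add: strict_sorted_iff distinct_map)
  then have "strict_mono_on {0..<d} (x \<circ> p)"
    by (intro strict_mono_onI) (auto dest: sorted_wrt_nth_less simp flip: nth)
  with p' show thesis by (rule that)
qed

text \<open>Sorting distinct nodes permutes the rows of both determinants by the same
  \<open>p\<close>, so both have the sign of \<open>p\<close> and their product is positive. If two
  nodes coincide, equal rows make the product zero.\<close>

lemma det_powers_mult_nonneg_pos:
  fixes x :: "nat \<Rightarrow> real" and r t :: "nat \<Rightarrow> nat"
  assumes r: "strict_mono_on {0..<d} r" and t: "strict_mono_on {0..<d} t"
    and x: "\<And>i. i < d \<Longrightarrow> 0 < x i"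
  shows "0 \<le> det (mat d d (\<lambda>(i, j). x i ^ t j)) * det (mat d d (\<lambda>(i, j). x i ^ r j))"
proof (cases "inj_on x {0..<d}")
  case True
  then obtain p where p: "p permutes {0..<d}" and mono: "strict_mono_on {0..<d} (x \<circ> p)"
    by (rule permutes_sort)
  have pd: "p i < d" if "i < d" for i using permutes_in_image[OF p, of i] that by auto
  have sign: "0 < signof p * det (mat d d (\<lambda>(i, j). x i ^ q j))"
    if "strict_mono_on {0..<d} q" for q
  proof -
    have "0 < det (mat d d (\<lambda>(i, j). (x \<circ> p) i ^ q j))"
      by (rule det_powers_pos[OF that mono]) (simp add: x pd)
    also have "mat d d (\<lambda>(i, j). (x \<circ> p) i ^ q j)
        = mat d d (\<lambda>(i, j). mat d d (\<lambda>(i, j). x i ^ q j) $$ (p i, j))"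
      by (rule eq_matI) (auto simp: pd)
    also have "det \<dots> = signof p * det (mat d d (\<lambda>(i, j). x i ^ q j))"
      by (rule det_permute_rows[OF _ p]) simp
    finally show ?thesis .
  qed
  from mult_pos_pos[OF sign[OF t] sign[OF r]] show ?thesis
    by (cases rule: sign_cases[of p]) auto
next
  case False
  then obtain i k where ik: "i < d" "k < d" "i \<noteq> k" "x i = x k"
    by (auto simp: inj_on_def)
  have "det (mat d d (\<lambda>(i, j). x i ^ r j)) = 0"
    by (rule det_identical_rows[of _ d i k]) (use ik in auto)
  then show ?thesis by simp
qed

text \<open>Coordinates equal to 0 are reached by a limit: shifting every node by
  \<open>e > 0\<close> gives positive nodes, and by the Leibniz formula the determinants are
  continuous in \<open>e\<close>.\<close>

lemma det_powers_mult_nonneg: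
  fixes x :: "nat \<Rightarrow> real" and r t :: "nat \<Rightarrow> nat"
  assumes r: "strict_mono_on {0..<d} r" and t: "strict_mono_on {0..<d} t"
    and x: "\<And>i. i < d \<Longrightarrow> 0 \<le> x i"
  shows "0 \<le> det (mat d d (\<lambda>(i, j). x i ^ t j)) * det (mat d d (\<lambda>(i, j). x i ^ r j))"
proof (rule tendsto_lowerbound)
  let ?D = "\<lambda>q e. det (mat d d (\<lambda>(i, j). (x i + e) ^ q j))"
  have "((\<lambda>e. ?D q e) \<longlongrightarrow> det (mat d d (\<lambda>(i, j). (x i + 0) ^ q j))) (at_right 0)"
    for q :: "nat \<Rightarrow> nat"
  proof -
    have "((\<lambda>e. \<Sum>p | p permutes {0..<d}. signof p * (\<Prod>i = 0..<d. (x i + e) ^ q (p i))) \<longlongrightarrow>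
        (\<Sum>p | p permutes {0..<d}. signof p * (\<Prod>i = 0..<d. (x i + 0) ^ q (p i)))) (at_right 0)"
      by (intro tendsto_intros)
    moreover have "?D q e
        = (\<Sum>p | p permutes {0..<d}. signof p * (\<Prod>i = 0..<d. (x i + e) ^ q (p i)))" for e
      unfolding det_def by (auto intro!: sum.cong prod.cong simp: permutes_in_image)
    moreover from this[of 0] have "det (mat d d (\<lambda>(i, j). (x i + 0) ^ q j))
        = (\<Sum>p | p permutes {0..<d}. signof p * (\<Prod>i = 0..<d. (x i + 0) ^ q (p i)))" .
    ultimately show ?thesis by (simp only:)
  qed
  from tendsto_mult[OF this this]
  show "((\<lambda>e. ?D t e * ?D r e) \<longlongrightarrow>
      det (mat d d (\<lambda>(i, j). x i ^ t j)) * det (mat d d (\<lambda>(i, j). x i ^ r j))) (at_right 0)"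
    by simp
  show "eventually (\<lambda>e. 0 \<le> ?D t e * ?D r e) (at_right 0)"
    using eventually_at_right_less[of 0]
    by eventually_elim (rule det_powers_mult_nonneg_pos[OF r t], use x in \<open>simp add: add_nonneg_pos\<close>)
qed simp

section \<open>The Andreief identity\<close>

text \<open>The Leibniz formula turns the product of determinants into a double sum, over
  permutations \<open>p\<close> and \<open>q\<close>, of products over the coordinates, which
  integrate factor by factor under the product measure. For fixed \<open>p\<close>, the sum over
  \<open>q\<close> is the determinant on the right with rows permuted by \<open>p\<close>; its sign
  cancels that of \<open>p\<close>, and \<open>d!\<close> equal terms remain.\<close>

lemma
  fixes f g :: "nat \<Rightarrow> 'a \<Rightarrow> real"
  assumes \<nu>: "sigma_finite_measure \<nu>"
    and int: "\<And>i j. i < d \<Longrightarrow> j < d \<Longrightarrow> integrable \<nu> (\<lambda>x. f i x * g j x)"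
  shows andreief_integrable: "integrable (Pi\<^sub>M {0..<d} (\<lambda>_. \<nu>))
      (\<lambda>x. det (mat d d (\<lambda>(i, j). f j (x i))) * det (mat d d (\<lambda>(i, j). g j (x i))))" (is ?int)
    and andreief_integral: "(\<integral>x. det (mat d d (\<lambda>(i, j). f j (x i)))
        * det (mat d d (\<lambda>(i, j). g j (x i))) \<partial>Pi\<^sub>M {0..<d} (\<lambda>_. \<nu>))
      = fact d * det (mat d d (\<lambda>(i, j). \<integral>x. f i x * g j x \<partial>\<nu>))" (is ?eq)
proof -
  interpret product_sigma_finite "\<lambda>_::nat. \<nu>" using \<nu> by (simp add: product_sigma_finite_def)
  let ?N = "Pi\<^sub>M {0..<d} (\<lambda>_. \<nu>)"
  let ?P = "{p. p permutes {0..<d}}"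
  define A where "A = mat d d (\<lambda>(i, j). \<integral>x. f i x * g j x \<partial>\<nu>)"
  have lt: "p i < d" if "p \<in> ?P" "i < d" for p i
    using permutes_in_image[of p "{0..<d}" i] that by auto
  have expand: "det (mat d d (\<lambda>(i, j). f j (x i))) * det (mat d d (\<lambda>(i, j). g j (x i)))
      = (\<Sum>p\<in>?P. \<Sum>q\<in>?P. (signof p * signof q) * (\<Prod>i = 0..<d. f (p i) (x i) * g (q i) (x i)))" for x
  proof -
    have "det (mat d d (\<lambda>(i, j). h j (x i))) = (\<Sum>p\<in>?P. signof p * (\<Prod>i = 0..<d. h (p i) (x i)))"
      for h :: "nat \<Rightarrow> 'a \<Rightarrow> real"
      unfolding det_def by (auto intro!: sum.cong prod.cong simp: permutes_in_image)
    then show ?thesis by (simp add: sum_product prod.distrib ac_simps)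
  qed
  have int_prod: "integrable ?N (\<lambda>x. \<Prod>i = 0..<d. f (p i) (x i) * g (q i) (x i))"
    if "p \<in> ?P" "q \<in> ?P" for p q
    by (rule product_integrable_prod[where f = "\<lambda>i x. f (p i) x * g (q i) x"])
      (use that in \<open>auto intro: int lt\<close>)
  show ?int
    unfolding expand by (intro Bochner_Integration.integrable_sum integrable_mult_right int_prod)
  have "(\<integral>x. det (mat d d (\<lambda>(i, j). f j (x i))) * det (mat d d (\<lambda>(i, j). g j (x i))) \<partial>?N)
      = (\<Sum>p\<in>?P. \<Sum>q\<in>?P. (signof p * signof q) *
          (\<integral>x. (\<Prod>i = 0..<d. f (p i) (x i) * g (q i) (x i)) \<partial>?N))"
    unfolding expand
    by (subst Bochner_Integration.integral_sum,
        (intro Bochner_Integration.integrable_sum integrable_mult_right int_prod; assumption),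
        intro sum.cong refl, subst Bochner_Integration.integral_sum,
        (intro integrable_mult_right int_prod; assumption), simp)
  also have "\<dots> = (\<Sum>p\<in>?P. signof p * (\<Sum>q\<in>?P. signof q * (\<Prod>i = 0..<d. A $$ (p i, q i))))"
  proof (intro sum.cong refl, unfold sum_distrib_left, intro sum.cong refl)
    fix p q assume pq: "p \<in> ?P" "q \<in> ?P"
    have "(\<integral>x. (\<Prod>i = 0..<d. f (p i) (x i) * g (q i) (x i)) \<partial>?N)
        = (\<Prod>i = 0..<d. \<integral>x. f (p i) x * g (q i) x \<partial>\<nu>)"
      by (rule product_integral_prod[where f = "\<lambda>i x. f (p i) x * g (q i) x"])
        (use pq in \<open>auto intro: int lt\<close>)
    also have "\<dots> = (\<Prod>i = 0..<d. A $$ (p i, q i))"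
      using pq by (intro prod.cong) (auto simp: A_def lt)
    finally show "(signof p * signof q) *
          (\<integral>x. (\<Prod>i = 0..<d. f (p i) (x i) * g (q i) (x i)) \<partial>?N)
        = signof p * (signof q * (\<Prod>i = 0..<d. A $$ (p i, q i)))"
      by simp
  qed
  also have "\<dots> = (\<Sum>p\<in>?P. signof p * (signof p * det A))"
  proof (intro sum.cong refl arg_cong2[where f = "(*)"])
    fix p assume p: "p \<in> ?P"
    have "(\<Sum>q\<in>?P. signof q * (\<Prod>i = 0..<d. A $$ (p i, q i)))
        = det (mat d d (\<lambda>(i, j). A $$ (p i, j)))"
      unfolding det_def by (auto intro!: sum.cong prod.cong simp: permutes_in_image)
    also have "\<dots> = signof p * det A"
      using p by (intro det_permute_rows) (auto simp: A_def)
    finally show "(\<Sum>q\<in>?P. signof q * (\<Prod>i = 0..<d. A $$ (p i, q i))) = signof p * det A" .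
  qed
  also have "\<dots> = (\<Sum>p\<in>?P. det A)"
    by (intro sum.cong refl) (auto simp: sign_def)
  also have "\<dots> = fact d * det A"
    by (simp add: card_permutations[of "{0..<d}" d])
  finally show ?eq unfolding A_def .
qed

section \<open>Hausdorff moment sequences\<close>

text \<open>Restricting the measure to [0,1] turns set integrals into plain integrals and puts every
  point of the space in [0,1]. Finiteness gives the sigma-finiteness that product measures
  require.\<close>

lemma hausdorff_moment_sequence_measure:
  assumes "hausdorff_moment_sequence \<alpha>"
  obtains \<nu> :: "real measure" where "space \<nu> = {0..1}" "finite_measure \<nu>"
    "\<And>n. integrable \<nu> (\<lambda>x. x ^ n)" "\<And>n. \<alpha> n = (\<integral>x. x ^ n \<partial>\<nu>)"
    "(\<lambda>x. x) \<in> borel_measurable \<nu>"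
proof -
  obtain \<mu> :: "real measure" where \<mu>: "sets \<mu> = sets borel"
    and int: "\<And>n. set_integrable \<mu> {0..1} (\<lambda>x. x ^ n)"
    and eq: "\<And>n. \<alpha> n = set_lebesgue_integral \<mu> {0..1} (\<lambda>x. x ^ n)"
    using assms by (auto simp: hausdorff_moment_sequence_def)
  let ?\<nu> = "restrict_space \<mu> {0..1}"
  have sp: "space \<mu> = UNIV" using sets_eq_imp_space_eq[OF \<mu>] by simp
  have I: "{0..1} \<inter> space \<mu> \<in> sets \<mu>" using \<mu> sp by simp
  have int': "integrable ?\<nu> (\<lambda>x. x ^ n)" for n
    using int[of n] by (simp add: integrable_restrict_space[OF I] set_integrable_def)
  \<comment> \<open>The zeroth moment is the total mass.\<close>
  have "integrable ?\<nu> (\<lambda>_. 1 :: real)" using int'[of 0] by simp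
  then have "finite_measure ?\<nu>"
    by (intro finite_measureI) (simp add: integrable_iff_bounded)
  moreover have "\<alpha> n = (\<integral>x. x ^ n \<partial>?\<nu>)" for n
    by (simp add: eq integral_restrict_space[OF I] set_lebesgue_integral_def)
  moreover have "(\<lambda>x. x) \<in> borel_measurable ?\<nu>"
    using \<mu> by (intro measurable_restrict_space1) (simp add: measurable_def sp)
  moreover have "space ?\<nu> = {0..1}" by (simp add: space_restrict_space sp)
  ultimately show thesis using int' by (intro that[of ?\<nu>])
qed

text \<open>The representing measure is the image under \<open>\<phi>\<close> of the measure with
  density \<open>w\<close> with respect to \<open>M\<close>; the moments follow by change of
  variables.\<close>

lemma hausdorff_moment_sequenceI_distr:
  fixes \<phi> w :: "'a \<Rightarrow> real"
  assumes \<phi>: "\<phi> \<in> borel_measurable M" "\<And>x. x \<in> space M \<Longrightarrow> \<phi> x \<in> {0..1}"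
    and w: "w \<in> borel_measurable M" "\<And>x. x \<in> space M \<Longrightarrow> 0 \<le> w x"
    and int: "\<And>n. integrable M (\<lambda>x. \<phi> x ^ n * w x)"
    and eq: "\<And>n. \<alpha> n = (\<integral>x. \<phi> x ^ n * w x \<partial>M)"
  shows "hausdorff_moment_sequence \<alpha>"
proof -
  define \<rho> where "\<rho> = density M (\<lambda>x. ennreal (w x))"
  define \<kappa> where "\<kappa> = distr \<rho> borel \<phi>"
  note [measurable] = \<phi>(1) w(1)
  have \<phi>\<rho>[measurable]: "\<phi> \<in> borel_measurable \<rho>" by (simp add: \<rho>_def)
  \<comment> \<open>The indicator equals 1 because \<open>\<phi>\<close> maps into [0,1].\<close>
  have cong: "w x *\<^sub>R (indicator {0..1} (\<phi> x) *\<^sub>R \<phi> x ^ n) = \<phi> x ^ n * w x"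
    if "x \<in> space M" for x n
    using \<phi>(2)[OF that] by (simp add: indicator_def)
  have "measure_support \<kappa> \<subseteq> {0..1}"
  proof
    fix y assume y: "y \<in> measure_support \<kappa>"
    \<comment> \<open>The complement of [0,1] is open and has an empty preimage, hence is a null set
      that misses the support.\<close>
    have "\<phi> -` (- {0..1}) \<inter> space \<rho> = {}"
      using \<phi>(2) by (auto simp: \<rho>_def)
    then have "emeasure \<kappa> (- {0..1}) = 0"
      unfolding \<kappa>_def by (subst emeasure_distr) auto
    then show "y \<in> {0..1}"
      using y by (auto simp: measure_support_def dest!: spec[of _ "- {0..1}"])
  qed
  moreover have "set_integrable \<kappa> {0..1} (\<lambda>y. y ^ n)" for n
  proof -
    have "integrable M (\<lambda>x. w x *\<^sub>R (indicator {0..1} (\<phi> x) *\<^sub>R \<phi> x ^ n))"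
      using int[of n] by (subst Bochner_Integration.integrable_cong[OF refl cong]) auto
    then have "integrable \<rho> (\<lambda>x. indicator {0..1} (\<phi> x) *\<^sub>R \<phi> x ^ n)"
      unfolding \<rho>_def by (subst integrable_density) (auto simp: w(2))
    then show ?thesis
      unfolding set_integrable_def \<kappa>_def by (subst integrable_distr_eq) auto
  qed
  moreover have "\<alpha> n = set_lebesgue_integral \<kappa> {0..1} (\<lambda>y. y ^ n)" for n
  proof -
    have "set_lebesgue_integral \<kappa> {0..1} (\<lambda>y. y ^ n)
        = (\<integral>x. indicator {0..1} (\<phi> x) *\<^sub>R \<phi> x ^ n \<partial>\<rho>)"
      unfolding set_lebesgue_integral_def \<kappa>_def by (subst integral_distr) auto
    also have "\<dots> = (\<integral>x. w x *\<^sub>R (indicator {0..1} (\<phi> x) *\<^sub>R \<phi> x ^ n) \<partial>M)"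
      unfolding \<rho>_def by (subst integral_density) (auto simp: w(2))
    also have "\<dots> = \<alpha> n"
      unfolding eq by (rule Bochner_Integration.integral_cong[OF refl cong])
    finally show ?thesis by simp
  qed
  ultimately show ?thesis
    unfolding hausdorff_moment_sequence_def by (intro exI[of _ \<kappa>]) (auto simp: \<kappa>_def)
qed

theorem corollary4p4:
  fixes d :: nat and r t :: "nat \<Rightarrow> nat" and \<alpha> :: "nat \<Rightarrow> real"
  assumes "d \<ge> 2"
    and "r 0 = 0" and "strict_mono_on {0..<d} r"
    and "t 0 = 0" and "strict_mono_on {0..<d} t"
    and "hausdorff_moment_sequence \<alpha>"
  shows "hausdorff_moment_sequence
           (\<lambda>n. Determinant.det (Matrix.mat d d (\<lambda>(i, j). \<alpha> (n + r j + t i))))"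
proof -
  obtain \<nu> :: "real measure" where \<nu>: "space \<nu> = {0..1}" "finite_measure \<nu>"
    and int: "\<And>n. integrable \<nu> (\<lambda>x. x ^ n)" and \<alpha>: "\<And>n. \<alpha> n = (\<integral>x. x ^ n \<partial>\<nu>)"
    and meas: "(\<lambda>x. x) \<in> borel_measurable \<nu>"
    using assms(6) by (rule hausdorff_moment_sequence_measure) blast
  interpret finite_measure \<nu> by fact
  let ?N = "Pi\<^sub>M {0..<d} (\<lambda>_. \<nu>)"
  let ?D = "\<lambda>q x. det (mat d d (\<lambda>(i, j). x i ^ q j))"
  define \<phi> :: "(nat \<Rightarrow> real) \<Rightarrow> real" where "\<phi> x = (\<Prod>i = 0..<d. x i)" for x
  \<comment> \<open>Dividing by \<open>fact d\<close> cancels the factor in the Andreief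
    identity.\<close>
  define w :: "(nat \<Rightarrow> real) \<Rightarrow> real" where "w x = ?D t x * ?D r x / fact d" for x
  have space: "x i \<in> {0..1}" if "x \<in> space ?N" "i < d" for x i
    using that \<nu>(1) by (auto simp: space_PiM PiE_def Pi_def)
  have andreief: "integrable ?N (\<lambda>x. ?D (\<lambda>j. n + t j) x * ?D r x)"
    "(\<integral>x. ?D (\<lambda>j. n + t j) x * ?D r x \<partial>?N)
      = fact d * det (mat d d (\<lambda>(i, j). \<integral>x. x ^ (n + t i) * x ^ r j \<partial>\<nu>))" for n
    using andreief_integrable[OF sigma_finite_measure_axioms,
        where f = "\<lambda>i x. x ^ (n + t i)" and g = "\<lambda>j x. x ^ r j"]
      andreief_integral[OF sigma_finite_measure_axioms,
        where f = "\<lambda>i x. x ^ (n + t i)" and g = "\<lambda>j x. x ^ r j"]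
      int by (simp_all flip: power_add)
  \<comment> \<open>Row \<open>i\<close> of the first determinant has the common factor
    \<open>x i ^ n\<close>; together these factors form \<open>\<phi> x ^ n\<close>.\<close>
  have factor: "\<phi> x ^ n * w x = ?D (\<lambda>j. n + t j) x * ?D r x / fact d" for x n
  proof -
    have "?D (\<lambda>j. n + t j) x = \<phi> x ^ n * ?D t x"
      unfolding det_def \<phi>_def
      by (auto simp: power_add prod.distrib prod_power_distrib sum_distrib_left permutes_in_image
          intro!: sum.cong)
    then show ?thesis by (simp add: w_def)
  qed
  have integrable: "integrable ?N (\<lambda>x. \<phi> x ^ n * w x)" for n
    unfolding factor using andreief(1)[of n] by simp
  show ?thesis
  proof (rule hausdorff_moment_sequenceI_distr[of \<phi> ?N w])
    show "\<phi> \<in> borel_measurable ?N"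
      unfolding \<phi>_def
      by (intro borel_measurable_prod measurable_compose[OF _ meas] measurable_component_singleton)
    show "w \<in> borel_measurable ?N"
      \<comment> \<open>For \<open>n = 0\<close> the integrable function is \<open>w\<close> itself,
        so its measurability comes for free.\<close>
      using integrable[of 0] by simp
    show "\<phi> x \<in> {0..1}" if "x \<in> space ?N" for x
      using space[OF that] by (auto simp: \<phi>_def intro!: prod_nonneg prod_le_1)
    show "0 \<le> w x" if "x \<in> space ?N" for x
      unfolding w_def using space[OF that]
      by (intro divide_nonneg_pos det_powers_mult_nonneg assms) auto
    show "det (mat d d (\<lambda>(i, j). \<alpha> (n + r j + t i))) = (\<integral>x. \<phi> x ^ n * w x \<partial>?N)" for n
    proof -
      have "(\<lambda>(i, j). \<integral>x. x ^ (n + t i) * x ^ r j \<partial>\<nu>) = (\<lambda>(i, j). \<alpha> (n + r j + t i))"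
        by (simp add: \<alpha> ac_simps flip: power_add)
      then show ?thesis
        unfolding factor using andreief(2)[of n] by simp
    qed
  qed (fact integrable)
qed

end
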